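(* Let $\mathcal A=(S,E,\ell,s_0,d,(g_i)_{i\in S})$ be a destination-complete symbolic DLSL system with dwell over a finite input alphabet $\Omega$. Let $T=(Q,q_0,\Omega,S,\Delta,\lambda)$ be any deterministic graph-respecting labeled transducer for $(S,E)$ equivalent to $\mathcal A$. Fix a reachable visible state $i\in S$ such that $\mathrm{Out}(i)\setminus\{i\}\neq\varnothing$ and at least one non-self departure from $i$ is realizable (there are $j\in\mathrm{Out}(i)\setminus\{i\}$ and $b\in\Omega$ with $g_i(b)=\ell(j)$). Then $$|\lambda^{-1}(i)|\ge d_i .$$ Consequently, if every visible state is reachable and admits a realizable non-self departure, then $$|Q|\ge\sum_{i\in S}d_i .$$
   Context: Visible graph. $S$ is a finite set (visible states), $E\subseteq S\times S$, $\mathrm{Out}(i)=\{j\in S:(i,j)\in E\}$. A labeling $\ell:S\to\Sigma$ into a finite alphabet makes the graph destination-labeled: edge $(i,j)$ carries label $\ell(j)$. The graph is self-looping if $(i,i)\in E$ for all $i$. It is label-deterministic if for every $i\in S$, $a\in\Sigma$ there is at most one $j\in\mathrm{Out}(i)$ with $\ell(j)=a$. Put $\Sigma_i=\{\ell(j):j\in\mathrm{Out}(i)\}$ and, for $a\in\Sigma_i$, let $\delta(i,a)$ be the unique $j\in\mathrm{Out}(i)$ with $\ell(j)=a$. A symbolic DLSL system with dwell is $\mathcal A=(S,E,\ell,s_0,d,(g_i)_{i\in S})$ where $(S,E,\ell)$ is destination-labeled, self-looping and label-deterministic, $s_0\in S$, $d:S\to\mathbb N_{\ge1}$, $i\mapsto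 d_i$, and $g_i:\Omega\to\Sigma_i$ for each $i$. Its operational states are pairs $(i,r)$, $0\le r\le d_i-1$, updated on input $u\in\Omega$ by $(i,r)\mapsto(i,r-1)$ if $r>0$, and $(i,0)\mapsto(j,d_j-1)$ with $j=\delta(i,g_i(u))$. Starting from $(y_0,r_0)=(s_0,d_{s_0}-1)$ and reading $w=u_1\cdots u_n$ one obtains $(y_1,r_1),\dots,(y_n,r_n)$, and $\mathrm{Out}_{\mathcal A}(w):=y_1\cdots y_n$. The system is destination-complete if for every $i\in S$ and $a\in\Sigma_i$ there is $u\in\Omega$ with $g_i(u)=a$. A visible state is reachable if it is reached from $s_0$ by some input word. A graph-respecting labeled transducer for $(S,E)$ is a deterministic transducer $T=(Q,q_0,\Omega,S,\Delta,\lambda)$ with $\Delta:Q\times\Omega\to Q$, $\lambda:Q\to S$ surjective, and $\lambda(\Delta(q,u))\in\mathrm{Out}(\lambda(q))$ for all $q\in Q,u\in\Omega$. Its emitted symbol after reading one input is the visible label $\lambda$ of the successor control state. $T$ is equivalent to $\mathcal A$ if for every $w\in\Omega^*$ the output word emitted by $T$ from $q_0$ equals $\mathrm{Out}_{\mathcal A}(w)$. *)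

theory Defs
  imports "HOL-Library.Equipollence"
begin

text \<open>
  All carriers (visible states, label alphabet \<open>\<Sigma>\<close>, input alphabet \<open>\<Omega>\<close>, control states) are
  explicit sets; the functions in the records below are only constrained on these carriers.
\<close>

section \<open>Symbolic DLSL systems with dwell\<close>

record ('s, 'l, 'u) dlsl =
  states :: "'s set"
  edges  :: "('s \<times> 's) set"
  label  :: "'s \<Rightarrow> 'l"
  start  :: 's
  dwell  :: "'s \<Rightarrow> nat"
  guard  :: "'s \<Rightarrow> 'u \<Rightarrow> 'l"

definition out_nbrs :: "'s set \<Rightarrow> ('s \<times> 's) set \<Rightarrow> 's \<Rightarrow> 's set" where
  "out_nbrs S E i = {j \<in> S. (i, j) \<in> E}"

abbreviation Out :: "('s, 'l, 'u) dlsl \<Rightarrow> 's \<Rightarrow> 's set" where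
  "Out A i \<equiv> out_nbrs (states A) (edges A) i"

definition self_looping :: "'s set \<Rightarrow> ('s \<times> 's) set \<Rightarrow> bool" where
  "self_looping S E \<longleftrightarrow> (\<forall>i\<in>S. (i, i) \<in> E)"

definition label_deterministic :: "'l set \<Rightarrow> 's set \<Rightarrow> ('s \<times> 's) set \<Rightarrow> ('s \<Rightarrow> 'l) \<Rightarrow> bool" where
  "label_deterministic \<Sigma> S E lab \<longleftrightarrow>
     (\<forall>i\<in>S. \<forall>a\<in>\<Sigma>. \<exists>\<^sub>\<le>\<^sub>1 j. j \<in> out_nbrs S E i \<and> lab j = a)"

definition out_labels :: "('s, 'l, 'u) dlsl \<Rightarrow> 's \<Rightarrow> 'l set" where
  "out_labels A i = label A ` Out A i"

definition succ_by_label :: "('s, 'l, 'u) dlsl \<Rightarrow> 's \<Rightarrow> 'l \<Rightarrow> 's" where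
  "succ_by_label A i a = (THE j. j \<in> Out A i \<and> label A j = a)"

definition dlsl_system :: "'l set \<Rightarrow> 'u set \<Rightarrow> ('s, 'l, 'u) dlsl \<Rightarrow> bool" where
  "dlsl_system \<Sigma> \<Omega> A \<longleftrightarrow>
     finite (states A) \<and> edges A \<subseteq> states A \<times> states A \<and>
     finite \<Sigma> \<and> label A \<in> states A \<rightarrow> \<Sigma> \<and>
     self_looping (states A) (edges A) \<and>
     label_deterministic \<Sigma> (states A) (edges A) (label A) \<and>
     start A \<in> states A \<and>
     (\<forall>i\<in>states A. 1 \<le> dwell A i) \<and>
     (\<forall>i\<in>states A. guard A i \<in> \<Omega> \<rightarrow> out_labels A i)"

definition destination_complete :: "'u set \<Rightarrow> ('s, 'l, 'u) dlsl \<Rightarrow> bool" where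
  "destination_complete \<Omega> A \<longleftrightarrow>
     (\<forall>i\<in>states A. \<forall>a\<in>out_labels A i. \<exists>u\<in>\<Omega>. guard A i u = a)"

fun op_step :: "('s, 'l, 'u) dlsl \<Rightarrow> 's \<times> nat \<Rightarrow> 'u \<Rightarrow> 's \<times> nat" where
  "op_step A (i, r) u =
     (if r > 0 then (i, r - 1)
      else let j = succ_by_label A i (guard A i u) in (j, dwell A j - 1))"

definition op_start :: "('s, 'l, 'u) dlsl \<Rightarrow> 's \<times> nat" where
  "op_start A = (start A, dwell A (start A) - 1)"

primrec op_outputs :: "('s, 'l, 'u) dlsl \<Rightarrow> 's \<times> nat \<Rightarrow> 'u list \<Rightarrow> 's list" where
  "op_outputs A x [] = []"
| "op_outputs A x (u # w) = fst (op_step A x u) # op_outputs A (op_step A x u) w"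

definition output_word :: "('s, 'l, 'u) dlsl \<Rightarrow> 'u list \<Rightarrow> 's list" where
  "output_word A w = op_outputs A (op_start A) w"

definition reachable :: "'u set \<Rightarrow> ('s, 'l, 'u) dlsl \<Rightarrow> 's \<Rightarrow> bool" where
  "reachable \<Omega> A i \<longleftrightarrow> (\<exists>w\<in>lists \<Omega>. fst (foldl (op_step A) (op_start A) w) = i)"

definition realizable_departure :: "'u set \<Rightarrow> ('s, 'l, 'u) dlsl \<Rightarrow> 's \<Rightarrow> bool" where
  "realizable_departure \<Omega> A i \<longleftrightarrow>
     (\<exists>j\<in>Out A i - {i}. \<exists>b\<in>\<Omega>. guard A i b = label A j)"

section \<open>Graph-respecting labeled transducers\<close>

record ('q, 's, 'u) transducer =
  control :: "'q set"
  initial :: 'q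
  delta   :: "'q \<Rightarrow> 'u \<Rightarrow> 'q"
  visible :: "'q \<Rightarrow> 's"

text \<open>
  The set of control states is not required to be finite, and the visible label of the initial
  control state is unconstrained: it is never emitted.
\<close>

definition graph_respecting_transducer ::
    "'u set \<Rightarrow> 's set \<Rightarrow> ('s \<times> 's) set \<Rightarrow> ('q, 's, 'u) transducer \<Rightarrow> bool" where
  "graph_respecting_transducer \<Omega> S E T \<longleftrightarrow>
     initial T \<in> control T \<and>
     (\<forall>q\<in>control T. \<forall>u\<in>\<Omega>. delta T q u \<in> control T) \<and>
     visible T ` control T = S \<and>
     (\<forall>q\<in>control T. \<forall>u\<in>\<Omega>. visible T (delta T q u) \<in> out_nbrs S E (visible T q))"

primrec emitted :: "('q, 's, 'u) transducer \<Rightarrow> 'q \<Rightarrow> 'u list \<Rightarrow> 's list" where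
  "emitted T q [] = []"
| "emitted T q (u # w) = visible T (delta T q u) # emitted T (delta T q u) w"

definition equivalent_to :: "'u set \<Rightarrow> ('q, 's, 'u) transducer \<Rightarrow> ('s, 'l, 'u) dlsl \<Rightarrow> bool" where
  "equivalent_to \<Omega> T A \<longleftrightarrow> (\<forall>w\<in>lists \<Omega>. emitted T (initial T) w = output_word A w)"

definition visible_fiber :: "('q, 's, 'u) transducer \<Rightarrow> 's \<Rightarrow> 'q set" where
  "visible_fiber T i = {q \<in> control T. visible T q = i}"

text \<open>
  As control state sets may be infinite, where \<open>card\<close> is 0 by convention, the bound
  \<open>\<bar>X\<bar> \<ge> n\<close> is expressed by \<open>{..<n} \<lesssim> X\<close>; for finite \<open>X\<close> this is \<open>n \<le> card X\<close>.
\<close>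

end

theory Submission
  imports Defs
begin

text \<open>
  If a control state \<open>q\<close> simulates two operational states \<open>(i, r)\<close> and \<open>(i, r')\<close> with \<open>r < r'\<close>,
  feed it \<open>r + 1\<close> copies of a letter \<open>b\<close> realizing a departure from \<open>i\<close>: the first operational
  state has left \<open>i\<close>, the second has not, a contradiction. So the \<open>d\<^sub>i\<close> operational states over \<open>i\<close>
  need different control states. The start state is the delicate case, because the initial control
  state may carry any visible label; using destination completeness one lets the dwell at \<open>i\<close> expire
  and takes the self-loop, after which all of \<open>(i, d\<^sub>i - 1), \<dots>, (i, 0)\<close> are entered by
  transitions that emit \<open>i\<close>.
\<close>

text \<open>Only future outputs are compared; \<open>visible T q = i\<close> is not demanded for
  \<open>x = (i, r)\<close>. This lets the initial control state simulate \<open>op_start A\<close>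
  although its own visible label is never emitted.\<close>

definition simulates ::
    "'u set \<Rightarrow> ('q, 's, 'u) transducer \<Rightarrow> ('s, 'l, 'u) dlsl \<Rightarrow> 'q \<Rightarrow> 's \<times> nat \<Rightarrow> bool" where
  "simulates \<Omega> T A q x \<longleftrightarrow>
     q \<in> control T \<and> (\<forall>w\<in>lists \<Omega>. emitted T q w = op_outputs A x w)"

lemma simulates_step:
  assumes "graph_respecting_transducer \<Omega> S E T" "simulates \<Omega> T A q x" "u \<in> \<Omega>"
  shows "simulates \<Omega> T A (delta T q u) (op_step A x u)"
    and "visible T (delta T q u) = fst (op_step A x u)"
proof -
  have eq: "emitted T q (u # w) = op_outputs A x (u # w)" if "w \<in> lists \<Omega>" for w
  proof -
    have "u # w \<in> lists \<Omega>"
      using assms(3) that by simp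
    then show ?thesis
      using assms(2) unfolding simulates_def by (elim conjE bspec)
  qed
  have "delta T q u \<in> control T"
    using assms unfolding graph_respecting_transducer_def simulates_def by blast
  then show "simulates \<Omega> T A (delta T q u) (op_step A x u)"
    using eq unfolding simulates_def by simp
  show "visible T (delta T q u) = fst (op_step A x u)"
    using eq[of "[]"] by simp
qed

lemma simulates_foldl:
  assumes "graph_respecting_transducer \<Omega> S E T" "simulates \<Omega> T A q x" "w \<in> lists \<Omega>"
  shows "simulates \<Omega> T A (foldl (delta T) q w) (foldl (op_step A) x w)"
  using assms(2,3)
proof (induction w arbitrary: q x)
  case (Cons u w)
  then have "u \<in> \<Omega>" "w \<in> lists \<Omega>"
    by auto
  from Cons.IH[OF simulates_step(1)[OF assms(1) Cons.prems(1) this(1)] this(2)] show ?case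
    by (simp del: op_step.simps)
qed simp

lemma foldl_op_step_dwell: "foldl (op_step A) (i, r) (replicate r u) = (i, 0)"
  by (induction r) auto

lemma op_outputs_dwell: "n \<le> r \<Longrightarrow> op_outputs A (i, r) (replicate n u) = replicate n i"
  by (induction n arbitrary: r) auto

text \<open>With counter \<open>r\<close> the guard is first consulted on letter
  \<open>r + 1\<close>, hence the word length \<open>Suc r\<close>.\<close>

lemma op_outputs_departure:
  "op_outputs A (i, r) (replicate (Suc r) u) = replicate r i @ [succ_by_label A i (guard A i u)]"
  by (induction r) (auto simp: Let_def)

text \<open>Label-determinism makes the \<open>THE\<close> in \<open>succ_by_label\<close>
  meaningful; this resolves both the self-loop at \<open>i\<close> and the departure from
  \<open>i\<close>.\<close>

lemma succ_by_label_eq: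
  assumes "dlsl_system \<Sigma> \<Omega> A" "i \<in> states A" "j \<in> Out A i"
  shows "succ_by_label A i (label A j) = j"
proof -
  have "label A j \<in> \<Sigma>"
    using assms by (auto simp: dlsl_system_def out_nbrs_def)
  then have "\<exists>\<^sub>\<le>\<^sub>1 k. k \<in> Out A i \<and> label A k = label A j"
    using assms by (auto simp: dlsl_system_def label_deterministic_def)
  then show ?thesis
    unfolding succ_by_label_def using assms(3) by (intro the1_equality') auto
qed

lemma fiber_state_simulating:
  assumes sys: "dlsl_system \<Sigma> \<Omega> A" and compl: "destination_complete \<Omega> A"
    and T: "graph_respecting_transducer \<Omega> (states A) (edges A) T"
    and equiv: "equivalent_to \<Omega> T A"
    and i: "i \<in> states A" "reachable \<Omega> A i" and k: "k < dwell A i"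
  shows "\<exists>q\<in>visible_fiber T i. simulates \<Omega> T A q (i, k)"
proof -
  have self: "i \<in> Out A i"
    using sys i(1) by (auto simp: dlsl_system_def self_looping_def out_nbrs_def)
  \<comment> \<open>This letter both counts the dwell down and, at counter 0, takes the
    self-loop.\<close>
  then obtain u where u: "u \<in> \<Omega>" "guard A i u = label A i"
    using compl i(1) unfolding destination_complete_def out_labels_def by blast
  have "simulates \<Omega> T A (initial T) (op_start A)"
    using equiv T
    by (simp add: simulates_def equivalent_to_def output_word_def graph_respecting_transducer_def)
  moreover obtain w r where w: "w \<in> lists \<Omega>" "foldl (op_step A) (op_start A) w = (i, r)"
    using i(2) unfolding reachable_def by (metis prod.collapse)
  ultimately have "simulates \<Omega> T A (foldl (delta T) (initial T) w) (i, r)"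
    using simulates_foldl[OF T] by metis
  moreover have "replicate r u \<in> lists \<Omega>"
    using u by auto
  \<comment> \<open>If \<open>w\<close> is empty and \<open>r = 0\<close>, this may be the initial
    control state, so its membership in the fiber is not claimed.\<close>
  ultimately obtain q where q: "simulates \<Omega> T A q (i, 0)"
    using simulates_foldl[OF T] foldl_op_step_dwell by metis
  have enter: "op_step A (i, 0) u = (i, dwell A i - 1)"
    using u succ_by_label_eq[OF sys i(1) self] by (simp add: Let_def)
  \<comment> \<open>Downward induction from \<open>dwell A i - 1\<close>: each control state found
    is the target of a transition emitting \<open>i\<close>, which puts it into the fiber.\<close>
  have "k \<le> dwell A i - 1"
    using k by simp
  then show ?thesis
  proof (induction rule: inc_induct)
    case base
    show ?case
      using simulates_step[OF T q u(1)] enter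
      by (auto simp: visible_fiber_def simulates_def)
  next
    case (step m)
    then obtain p where "simulates \<Omega> T A p (i, Suc m)"
      by blast
    from simulates_step[OF T this u(1)] show ?case
      by (auto simp: visible_fiber_def simulates_def)
  qed
qed

lemma simulates_dwell_inject:
  assumes sys: "dlsl_system \<Sigma> \<Omega> A" and i: "i \<in> states A" and "realizable_departure \<Omega> A i"
    and sim: "simulates \<Omega> T A q (i, k)" "simulates \<Omega> T A q (i, m)"
  shows "k = m"
proof -
  obtain j b where j: "j \<in> Out A i" "j \<noteq> i" and b: "b \<in> \<Omega>" "guard A i b = label A j"
    using assms(3) unfolding realizable_departure_def by blast
  have "\<not> r < s" if "simulates \<Omega> T A q (i, r)" "simulates \<Omega> T A q (i, s)" for r s
  proof
    assume "r < s"
    have "replicate (Suc r) b \<in> lists \<Omega>"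
      using b by auto
    then have "op_outputs A (i, r) (replicate (Suc r) b) = op_outputs A (i, s) (replicate (Suc r) b)"
      using that unfolding simulates_def by metis
    \<comment> \<open>Since \<open>Suc r \<le> s\<close>, the counter \<open>s\<close> outlasts the
      whole word; the two outputs then differ in the last letter, \<open>i\<close> against
      \<open>j\<close>.\<close>
    also have "\<dots> = replicate r i @ [i]"
      using op_outputs_dwell[of "Suc r" s A i b] \<open>r < s\<close> by (simp add: replicate_append_same)
    finally show False
      using op_outputs_departure[of A i r b] b j succ_by_label_eq[OF sys i j(1)] by simp
  qed
  then show ?thesis
    using sim by (meson linorder_neqE_nat)
qed

lemma dwell_lepoll_visible_fiber:
  assumes "dlsl_system \<Sigma> \<Omega> A" "destination_complete \<Omega> A"
    and "graph_respecting_transducer \<Omega> (states A) (edges A) T" "equivalent_to \<Omega> T A"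
    and "i \<in> states A" "reachable \<Omega> A i" "realizable_departure \<Omega> A i"
  shows "{..<dwell A i} \<lesssim> visible_fiber T i"
proof -
  obtain f where f: "\<forall>k\<in>{..<dwell A i}. f k \<in> visible_fiber T i \<and> simulates \<Omega> T A (f k) (i, k)"
    using fiber_state_simulating[OF assms(1-6)] by (metis lessThan_iff)
  \<comment> \<open>If \<open>f k = f m\<close>, this one control state simulates both
    \<open>(i, k)\<close> and \<open>(i, m)\<close>.\<close>
  then have "inj_on f {..<dwell A i}"
    using simulates_dwell_inject[OF assms(1,5,7)] by (metis inj_onI)
  then show ?thesis
    using f unfolding lepoll_def by blast
qed

text \<open>The disjoint sum \<open>Sigma I B\<close> mediates: the given injections combine
  fibrewise into it, and disjointness makes forgetting the index injective. No \<open>B i\<close>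
  has to be finite.\<close>

lemma sum_lepoll_UN:
  fixes d :: "'a \<Rightarrow> nat"
  assumes "finite I" and lep: "\<And>i. i \<in> I \<Longrightarrow> {..<d i} \<lesssim> B i"
    and disj: "pairwise (\<lambda>i j. disjnt (B i) (B j)) I"
  shows "{..<\<Sum>i\<in>I. d i} \<lesssim> (\<Union>i\<in>I. B i)"
proof -
  have "{..<\<Sum>i\<in>I. d i} \<approx> Sigma I (\<lambda>i. {..<d i})"
    using assms(1) by (simp add: eqpoll_iff_card)
  also have "\<dots> \<lesssim> Sigma I B"
    using lep by (rule Sigma_lepoll_mono[OF order_refl])
  also have "Sigma I B \<lesssim> (\<Union>i\<in>I. B i)"
  proof -
    have "inj_on snd (Sigma I B)"
      using disj by (auto simp: inj_on_def pairwise_def disjnt_def)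
    moreover have "snd ` Sigma I B \<subseteq> (\<Union>i\<in>I. B i)"
      by auto
    ultimately show ?thesis
      unfolding lepoll_def by blast
  qed
  finally show ?thesis .
qed

theorem theorem4p3:
  fixes \<Sigma> :: "'l set" and \<Omega> :: "'u set"
    and A :: "('s, 'l, 'u) dlsl" and T :: "('q, 's, 'u) transducer"
  assumes "finite \<Omega>"
    and "dlsl_system \<Sigma> \<Omega> A"
    and "destination_complete \<Omega> A"
    and "graph_respecting_transducer \<Omega> (states A) (edges A) T"
    and "equivalent_to \<Omega> T A"
  shows "(\<forall>i\<in>states A. reachable \<Omega> A i \<and> Out A i - {i} \<noteq> {} \<and> realizable_departure \<Omega> A i
            \<longrightarrow> {..<dwell A i} \<lesssim> visible_fiber T i)
       \<and> ((\<forall>i\<in>states A. reachable \<Omega> A i \<and> realizable_departure \<Omega> A i)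
            \<longrightarrow> {..<(\<Sum>i\<in>states A. dwell A i)} \<lesssim> control T)"
proof (intro conjI impI ballI)
  fix i
  assume "i \<in> states A"
    and "reachable \<Omega> A i \<and> Out A i - {i} \<noteq> {} \<and> realizable_departure \<Omega> A i"
  then show "{..<dwell A i} \<lesssim> visible_fiber T i"
    using dwell_lepoll_visible_fiber[OF assms(2-5)] by blast
next
  assume "\<forall>i\<in>states A. reachable \<Omega> A i \<and> realizable_departure \<Omega> A i"
  then have "{..<\<Sum>i\<in>states A. dwell A i} \<lesssim> (\<Union>i\<in>states A. visible_fiber T i)"
    using assms(2) dwell_lepoll_visible_fiber[OF assms(2-5)]
    \<comment> \<open>Fibers over distinct visible states are disjoint because each control state
      carries a single visible label.\<close>
    by (intro sum_lepoll_UN)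
      (auto simp: dlsl_system_def visible_fiber_def pairwise_def disjnt_def)
  also have "\<dots> \<lesssim> control T"
    by (rule subset_imp_lepoll) (auto simp: visible_fiber_def)
  finally show "{..<\<Sum>i\<in>states A. dwell A i} \<lesssim> control T" .
qed

end
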